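(* Let $x^*\in\mathbb{R}^p$ satisfy $F(x^* )=0$, and suppose that for every iterate $x^k$, $k\in\mathbb{N}$, of the Sketched Newton-Raphson (SNR) method one has $$f_{x^k}(x^* )\;\ge\; f_{x^k}(x^k)+\langle \nabla f_{x^k}(x^k),\,x^*-x^k\rangle .$$ If $0<\gamma<1$, then for every $k\ge 1$ $$\mathbb{E}\Big[\min_{t=0,\dots,k-1} f_{x^t}(x^t)\Big]\;\le\;\frac1k\sum_{t=0}^{k-1}\mathbb{E}\big[f_{x^t}(x^t)\big]\;\le\;\frac1k\,\frac{\|x^0-x^*\|^2}{2\gamma(1-\gamma)} .$$ In terms of $F$ and for $\gamma=1/2$ this gives $$\mathbb{E}\Big[\min_{t=0,\dots,k-1}\|F(x^t)\|^2_{\mathbb{E}[\mathbf{H}_{\mathbf{S}}(x^t)]}\Big]\;\le\;\frac{4\|x^0-x^*\|^2}{k}.$$ Besides, if the stochastic functions are star-convex along the iterates, i.e. for every $k$ and for all $\mathbf{S}_k\sim\mathcal{D}_{x^k}$ $$f_{\mathbf{S}_k,x^k}(x^* )\;\ge\; f_{\mathbf{S}_k,x^k}(x^k)+\langle\nabla f_{\mathbf{S}_k,x^k}(x^k),\,x^*-x^k\rangle ,$$ then the iterates are bounded with $\|x^k-x^*\|\le\|x^0-x^*\|$.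
   Context: $F:\mathbb{R}^p\to\mathbb{R}^m$ is continuously differentiable, and $DF(x)=[\nabla F_1(x)\ \cdots\ \nabla F_m(x)]\in\mathbb{R}^{p\times m}$ is the transpose of its Jacobian. For each $x\in\mathbb{R}^p$, $\mathcal{D}_x$ is a probability distribution over sketching matrices $\mathbf{S}\in\mathbb{R}^{m\times\tau}$. $\dagger$ denotes the Moore-Penrose pseudoinverse and $$\mathbf{H}_{\mathbf{S}}(x)=\mathbf{S}\big(\mathbf{S}^\top DF(x)^\top DF(x)\mathbf{S}\big)^\dagger\mathbf{S}^\top\in\mathbb{R}^{m\times m}.$$ For a symmetric positive semidefinite matrix $\mathbf{M}$, $\|v\|_{\mathbf{M}}=\sqrt{v^\top\mathbf{M}v}$ (a seminorm); $\|\cdot\|$ is the Euclidean norm. Expectations $\mathbb{E}[\mathbf{H}_{\mathbf{S}}(y)]$ are over $\mathbf{S}\sim\mathcal{D}_y$ and understood to be finite. Define, as functions of $x$ with $y$ and $\mathbf{S}$ fixed, $$f_{\mathbf{S},y}(x)=\tfrac12\|F(x)\|^2_{\mathbf{H}_{\mathbf{S}}(y)},\qquad f_y(x)=\mathbb{E}_{\mathbf{S}\sim\mathcal{D}_y}[f_{\mathbf{S},y}(x)]=\tfrac12\|F(x)\|^2_{\mathbb{E}[\mathbf{H}_{\mathbf{S}}(y)]}.$$ Gradients are with respect to $x$: $\nabla f_{\mathbf{S},y}(x)=DF(x)\mathbf{H}_{\mathbf{S}}(y)F(x)$ and $\nabla f_y(x)=DF(x)\mathbb{E}[\mathbf{H}_{\mathbf{S}}(y)]F(x)$;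 $\nabla f_{x^k}(x^k)$ means $\nabla f_y(x)$ evaluated at $x=y=x^k$. SNR method: given a deterministic $x^0\in\mathbb{R}^p$ and a stepsize $\gamma>0$, at each $k\ge0$ sample a fresh $\mathbf{S}_k\sim\mathcal{D}_{x^k}$ (conditionally on $x^k$) and set $$x^{k+1}=x^k-\gamma\,DF(x^k)\mathbf{S}_k\big(\mathbf{S}_k^\top DF(x^k)^\top DF(x^k)\mathbf{S}_k\big)^\dagger\mathbf{S}_k^\top F(x^k).$$ *)

theory Defs
  imports "HOL-Probability.Probability"
begin

definition pinv :: "real^'n^'m \<Rightarrow> real^'m^'n" where
  "pinv A = (THE X. A ** X ** A = A \<and> X ** A ** X = X \<and>
                transpose (A ** X) = A ** X \<and> transpose (X ** A) = X ** A)"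

definition mat_seminorm :: "real^'n^'n \<Rightarrow> real^'n \<Rightarrow> real" where
  "mat_seminorm M v = sqrt (v \<bullet> (M *v v))"

definition gradient :: "('a::real_inner \<Rightarrow> real) \<Rightarrow> 'a \<Rightarrow> 'a" where
  "gradient f x = (THE g. GDERIV f x :> g)"

(* Matrices with p rows and m columns have type real^'m^'p.  The columns of DF F x are the
   gradients of the components of F. *)

definition DF :: "(real^'p \<Rightarrow> real^'m) \<Rightarrow> real^'p \<Rightarrow> real^'m^'p" where
  "DF F x = transpose (jacobian F (at x))"

definition continuously_differentiable :: "(real^'p \<Rightarrow> real^'m) \<Rightarrow> bool" where
  "continuously_differentiable F \<longleftrightarrow>
     (\<forall>x. F differentiable (at x)) \<and> continuous_on UNIV (DF F)"

definition sketch_H :: "(real^'p \<Rightarrow> real^'m) \<Rightarrow> real^'t^'m \<Rightarrow> real^'p \<Rightarrow> real^'m^'m" where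
  "sketch_H F S x =
     S ** pinv (transpose S ** transpose (DF F x) ** DF F x ** S) ** transpose S"

definition expected_H ::
    "(real^'p \<Rightarrow> real^'m) \<Rightarrow> (real^'p \<Rightarrow> (real^'t^'m) measure) \<Rightarrow> real^'p \<Rightarrow> real^'m^'m" where
  "expected_H F D y = (\<integral>S. sketch_H F S y \<partial>D y)"

definition f_sketch :: "(real^'p \<Rightarrow> real^'m) \<Rightarrow> real^'t^'m \<Rightarrow> real^'p \<Rightarrow> real^'p \<Rightarrow> real" where
  "f_sketch F S y x = 1/2 * (mat_seminorm (sketch_H F S y) (F x))\<^sup>2"

definition f_mean ::
    "(real^'p \<Rightarrow> real^'m) \<Rightarrow> (real^'p \<Rightarrow> (real^'t^'m) measure) \<Rightarrow> real^'p \<Rightarrow> real^'p \<Rightarrow> real" where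
  "f_mean F D y x = (\<integral>S. f_sketch F S y x \<partial>D y)"

definition sketch_distributions ::
    "(real^'p \<Rightarrow> real^'m) \<Rightarrow> (real^'p \<Rightarrow> (real^'t^'m) measure) \<Rightarrow> bool" where
  "sketch_distributions F D \<longleftrightarrow>
     (\<forall>y. prob_space (D y) \<and> sets (D y) = sets borel \<and> integrable (D y) (\<lambda>S. sketch_H F S y))"

(* kappa is a regular conditional distribution of Y given the sub-sigma-algebra G. *)

definition cond_distributed ::
    "'w measure \<Rightarrow> 'w measure \<Rightarrow> 'b measure \<Rightarrow> ('w \<Rightarrow> 'b) \<Rightarrow> ('w \<Rightarrow> 'b measure) \<Rightarrow> bool" where
  "cond_distributed M G N Y \<kappa> \<longleftrightarrow>
     Y \<in> measurable M N \<and> \<kappa> \<in> measurable G (prob_algebra N) \<and>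
     (\<forall>B\<in>sets N. AE \<omega> in M.
        real_cond_exp M G (indicat_real (Y -` B \<inter> space M)) \<omega> = measure (\<kappa> \<omega>) B)"

(* The sigma-algebra generated by S 0, ..., S (k - 1); trivial for k = 0.  It carries the whole
   past of the method up to X k, because X 0 is deterministic. *)

definition history :: "'w measure \<Rightarrow> (nat \<Rightarrow> 'w \<Rightarrow> real^'t^'m) \<Rightarrow> nat \<Rightarrow> 'w measure" where
  "history M S k =
     vimage_algebra (space M) (\<lambda>\<omega>. \<lambda>i\<in>{..<k}. S i \<omega>) (\<Pi>\<^sub>M i\<in>{..<k}. borel)"

definition snr_step ::
    "(real^'p \<Rightarrow> real^'m) \<Rightarrow> real \<Rightarrow> real^'p \<Rightarrow> real^'t^'m \<Rightarrow> real^'p" where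
  "snr_step F \<gamma> x S = x - \<gamma> *\<^sub>R
     ((DF F x ** S ** pinv (transpose S ** transpose (DF F x) ** DF F x ** S) ** transpose S) *v F x)"

definition snr_process ::
    "'w measure \<Rightarrow> (real^'p \<Rightarrow> real^'m) \<Rightarrow> (real^'p \<Rightarrow> (real^'t^'m) measure) \<Rightarrow> real \<Rightarrow> real^'p
     \<Rightarrow> (nat \<Rightarrow> 'w \<Rightarrow> real^'t^'m) \<Rightarrow> (nat \<Rightarrow> 'w \<Rightarrow> real^'p) \<Rightarrow> bool" where
  "snr_process M F D \<gamma> x0 S X \<longleftrightarrow>
     prob_space M \<and>
     (\<forall>\<omega>\<in>space M. X 0 \<omega> = x0) \<and>
     (\<forall>k. \<forall>\<omega>\<in>space M. X (Suc k) \<omega> = snr_step F \<gamma> (X k \<omega>) (S k \<omega>)) \<and>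
     (\<forall>k. cond_distributed M (history M S k) borel (S k) (\<lambda>\<omega>. D (X k \<omega>)))"

definition star_ineq :: "('a::real_inner \<Rightarrow> real) \<Rightarrow> 'a \<Rightarrow> 'a \<Rightarrow> bool" where
  "star_ineq f x xs \<longleftrightarrow> f xs \<ge> f x + gradient f x \<bullet> (xs - x)"

end

theory Submission
  imports Defs
begin

text \<open>
  With \<open>D = DF F x\<close> and \<open>H\<close> the sketched matrix, the pseudoinverse identity \<open>G\<^sup>\<dagger> G G\<^sup>\<dagger> = G\<^sup>\<dagger>\<close> gives
  \<open>H D\<^sup>T D H = H\<close>, so the squared length of the direction \<open>D H F(x)\<close> is \<open>2 f\<^sub>S(x)\<close>.  As this
  direction is also the gradient of \<open>f\<^sub>S\<close>, the star inequality (with \<open>f\<^sub>S(x\<^sup>*) = 0\<close>) turns the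
  expansion of the square into the descent
  \<open>\<parallel>x\<^sup>+ - x\<^sup>*\<parallel>\<^sup>2 \<le> \<parallel>x - x\<^sup>*\<parallel>\<^sup>2 - 2 \<gamma> (1 - \<gamma>) f\<^sub>S(x)\<close>, pathwise in the stochastic case and in
  conditional expectation in the averaged case; the latter telescopes.  Making the iterates
  measurable requires that the discontinuous map \<open>pinv\<close> is Borel, which follows from its
  graph being closed.
\<close>

subsection \<open>The Moore--Penrose inverse\<close>

text \<open>The adjoint form in which matrices are moved across inner products. The simp rule
  \<open>transpose_matrix_vector\<close>, which turns \<open>transpose A *v x\<close> into
  \<open>x v* A\<close>, is deleted where this form has to survive.\<close>

lemma inner_matrix_vector:
  fixes A :: "real^'n^'m"
  shows "x \<bullet> (A *v y) = (transpose A *v x) \<bullet> y"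
  by (simp add: dot_lmul_matrix)

lemma matrix_add_rdistrib:
  fixes A :: "'a::semiring_1^'n^'m"
  shows "(A + B) ** C = A ** C + B ** C"
  by (vector matrix_matrix_mult_def distrib_right sum.distrib)

lemma matrix_diff_ldistrib:
  fixes A :: "'a::ring_1^'n^'m"
  shows "A ** (B - C) = A ** B - A ** C"
  by (vector matrix_matrix_mult_def right_diff_distrib sum_subtractf)

lemma matrix_diff_rdistrib:
  fixes A :: "'a::ring_1^'n^'m"
  shows "(A - B) ** C = A ** C - B ** C"
  by (vector matrix_matrix_mult_def left_diff_distrib sum_subtractf)

text \<open>The relation described by \<open>THE\<close> in \<open>pinv\<close>. As a relation it
  can be proved solvable and uniquely so, and its graph can be shown to be closed.\<close>

definition penrose :: "real^'n^'m \<Rightarrow> real^'m^'n \<Rightarrow> bool" where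
  "penrose A X \<longleftrightarrow> A ** X ** A = A \<and> X ** A ** X = X \<and>
     transpose (A ** X) = A ** X \<and> transpose (X ** A) = X ** A"

text \<open>\<open>A ** X\<close> and \<open>A ** Y\<close> are symmetric and each absorbs the
  other, so a transposition identifies them; likewise on the left. Then
  \<open>X = X ** A ** X = Y ** A ** X = Y ** A ** Y = Y\<close>.\<close>

lemma penrose_unique:
  assumes X: "penrose A X" and Y: "penrose A Y"
  shows "X = Y"
proof -
  have "A ** X = (A ** Y) ** (A ** X)"
    using Y by (simp add: penrose_def matrix_mul_assoc)
  also have "\<dots> = transpose ((A ** X) ** (A ** Y))"
    using X Y by (simp add: penrose_def matrix_transpose_mul[of "A ** X"])
  also have "(A ** X) ** (A ** Y) = A ** Y"
    using X by (simp add: penrose_def matrix_mul_assoc)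
  finally have right: "A ** X = A ** Y"
    using Y by (simp add: penrose_def)
  have "X ** A = (X ** A) ** (Y ** A)"
    using Y by (metis penrose_def matrix_mul_assoc)
  also have "\<dots> = transpose ((Y ** A) ** (X ** A))"
    using X Y by (simp add: penrose_def matrix_transpose_mul[of "Y ** A"])
  also have "(Y ** A) ** (X ** A) = Y ** A"
    using X by (metis penrose_def matrix_mul_assoc)
  finally have left: "X ** A = Y ** A"
    using Y by (simp add: penrose_def)
  have "X = X ** A ** X" using X by (simp add: penrose_def)
  also have "\<dots> = Y ** (A ** X)" by (simp add: left matrix_mul_assoc)
  also have "\<dots> = Y" using Y by (simp add: right penrose_def matrix_mul_assoc)
  finally show ?thesis .
qed

text \<open>Summing the components along an orthonormal basis \<open>B\<close> of \<open>V\<close>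
  gives a self-adjoint map into \<open>V\<close>; it fixes \<open>B\<close>, hence by linearity the
  span of \<open>B\<close>.\<close>

lemma orthogonal_projection_matrix:
  fixes V :: "(real^'n) set"
  assumes "subspace V"
  obtains Q :: "real^'n^'n" where "transpose Q = Q" "\<And>v. Q *v v \<in> V" "\<And>v. v \<in> V \<Longrightarrow> Q *v v = v"
proof -
  obtain B where B: "B \<subseteq> V" "pairwise orthogonal B" "\<And>x. x \<in> B \<Longrightarrow> norm x = 1"
      "independent B" "card B = dim V" "span B = V"
    using orthonormal_basis_subspace[OF assms] by metis
  have fin: "finite B" using B(4) by (rule independent_imp_finite)
  define q where "q v = (\<Sum>b\<in>B. (b \<bullet> v) *\<^sub>R b)" for v
  have "linear q"
    by (rule linearI) (simp_all add: q_def inner_add_right scaleR_add_left sum.distrib scaleR_sum_right)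
  then have mq: "matrix q *v v = q v" for v
    by (simp add: matrix_works)
  have fix_basis: "q c = c" if "c \<in> B" for c
  proof -
    have "(b \<bullet> c) *\<^sub>R b = (if b = c then c else 0)" if "b \<in> B" for b
      using that \<open>c \<in> B\<close> B(2,3) by (auto simp: pairwise_def orthogonal_def dot_square_norm)
    then show ?thesis
      using that fin by (simp add: q_def sum.delta)
  qed
  show thesis
  proof
    have "x \<bullet> (transpose (matrix q) *v y) = x \<bullet> (matrix q *v y)" for x y
    proof -
      have "x \<bullet> (transpose (matrix q) *v y) = q x \<bullet> y"
        by (simp add: inner_matrix_vector mq del: transpose_matrix_vector)
      also have "\<dots> = x \<bullet> q y"
        by (simp add: q_def inner_sum_left inner_sum_right inner_commute mult.commute)
      finally show ?thesis by (simp add: mq)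
    qed
    then show "transpose (matrix q) = matrix q"
      unfolding matrix_eq by (metis vector_eq_ldot)
    show "matrix q *v v \<in> V" for v
      using B(1) assms by (auto simp: mq q_def intro!: subspace_sum subspace_scale)
    show "matrix q *v v = v" if "v \<in> V" for v
      using that \<open>linear q\<close> fix_basis unfolding mq B(6)[symmetric]
      by (rule linear_eq_on_span[where g = "\<lambda>x. x", OF _ linear_id[unfolded id_def], rotated 2])
  qed
qed

text \<open>With \<open>Q\<close> the orthogonal projection onto the kernel of \<open>A\<close>, the matrix
  \<open>transpose A ** A + Q\<close> is invertible, and its inverse times \<open>transpose A\<close> is the pseudoinverse.\<close>

lemma penrose_exists:
  fixes A :: "real^'n^'m"
  shows "\<exists>X. penrose A X"
proof -
  have "subspace {v. A *v v = 0}"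
    by (auto simp: subspace_def matrix_vector_right_distrib matrix_vector_mult_scaleR)
  then obtain Q :: "real^'n^'n" where Q: "transpose Q = Q" "\<And>v. A *v (Q *v v) = 0"
      "\<And>v. A *v v = 0 \<Longrightarrow> Q *v v = v"
    by (rule orthogonal_projection_matrix) auto
  have AQ: "A ** Q = 0"
    using Q(2) by (simp add: matrix_eq matrix_vector_mul_assoc)
  have QQ: "Q ** Q = Q"
    using Q(2,3) by (simp add: matrix_eq flip: matrix_vector_mul_assoc)
  have QA: "Q ** transpose A = 0"
  proof -
    have "Q ** transpose A = transpose (A ** Q)"
      by (simp add: matrix_transpose_mul Q(1))
    then show ?thesis
      by (simp add: AQ transpose_def vec_eq_iff)
  qed
  define N where "N = transpose A ** A"
  define B where "B = N + Q"
  have symN: "transpose N = N"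
    by (simp add: N_def matrix_transpose_mul)
  have symB: "transpose B = B"
    using symN Q(1) by (simp add: B_def transpose_def vec_eq_iff)
  \<comment> \<open>As \<open>Q\<close> is a symmetric idempotent, the quadratic form of
    \<open>B\<close> is a sum of two squared norms. Both vanish, so \<open>v\<close> lies in the
    kernel of \<open>A\<close>, where \<open>v = Q *v v = 0\<close>.\<close>
  have "v = 0" if "B *v v = 0" for v
  proof -
    have "0 = v \<bullet> (B *v v)" by (simp add: that)
    also have "\<dots> = v \<bullet> (transpose A *v (A *v v)) + v \<bullet> (Q *v (Q *v v))"
      by (simp add: B_def N_def QQ matrix_vector_mult_add_rdistrib inner_add_right matrix_vector_mul_assoc
          del: transpose_matrix_vector)
    also have "\<dots> = (norm (A *v v))\<^sup>2 + (norm (Q *v v))\<^sup>2"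
      by (simp add: inner_matrix_vector Q(1) power2_norm_eq_inner del: transpose_matrix_vector)
    finally have "A *v v = 0" "Q *v v = 0"
      by (simp_all add: sum_power2_eq_zero_iff)
    with Q(3) show ?thesis by metis
  qed
  then obtain C where CB: "C ** B = mat 1"
    using matrix_left_invertible_ker[of B] by blast
  then have BC: "B ** C = mat 1"
    by (simp add: matrix_left_right_inverse)
  have symC: "transpose C = C"
  proof -
    have "transpose C = transpose C ** (B ** C)" by (simp add: BC)
    also have "\<dots> = transpose (B ** C) ** C"
      by (simp add: matrix_mul_assoc matrix_transpose_mul symB)
    finally show ?thesis by (simp add: BC)
  qed
  have NQ: "N ** Q = 0" by (simp add: N_def AQ flip: matrix_mul_assoc)
  \<comment> \<open>\<open>B\<close> acts as the identity on the range of \<open>Q\<close>, hence so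
    does its inverse \<open>C\<close>; this reduces \<open>C ** N\<close> to
    \<open>mat 1 - Q\<close>.\<close>
  have BQ: "B ** Q = Q" by (simp add: B_def matrix_add_rdistrib NQ QQ)
  have CQ: "C ** Q = Q" by (metis BQ CB matrix_mul_assoc matrix_mul_lid)
  have QC: "Q ** C = Q" by (metis CQ symC Q(1) matrix_transpose_mul)
  have CN: "C ** N = mat 1 - Q"
    using CB CQ by (simp add: B_def matrix_add_ldistrib eq_diff_eq)
  define X where "X = C ** transpose A"
  have XA: "X ** A = mat 1 - Q"
    by (simp add: X_def CN N_def[symmetric] flip: matrix_mul_assoc)
  have "A ** X ** A = A"
    by (simp add: XA matrix_diff_ldistrib AQ flip: matrix_mul_assoc)
  moreover have "X ** A ** X = X"
    unfolding XA by (simp add: X_def matrix_diff_rdistrib matrix_mul_assoc QC QA)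
  moreover have "transpose (X ** A) = X ** A"
    unfolding XA using Q(1) by (simp add: transpose_def vec_eq_iff mat_def)
  moreover have "transpose (A ** X) = A ** X"
    by (simp add: X_def matrix_transpose_mul symC matrix_mul_assoc)
  ultimately show ?thesis unfolding penrose_def by blast
qed

text \<open>Existence and uniqueness make the description meaningful; from here on
  \<open>pinv\<close> enters only through the four Penrose equations.\<close>

lemma pinv_eq_iff: "pinv A = X \<longleftrightarrow> penrose A X"
  unfolding pinv_def penrose_def[symmetric]
  by (metis penrose_exists penrose_unique theI)

lemma penrose_pinv: "penrose A (pinv A)"
  using pinv_eq_iff by blast

lemma pinv_mult_self: "pinv A ** A ** pinv A = pinv A"
  using penrose_pinv[of A] by (simp add: penrose_def)

lemma penrose_transpose: "penrose A X \<Longrightarrow> penrose (transpose A) (transpose X)"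
  unfolding penrose_def by (metis matrix_transpose_mul matrix_mul_assoc)

lemma transpose_pinv: "transpose (pinv A) = pinv (transpose A)"
  using pinv_eq_iff penrose_transpose[OF penrose_pinv] by metis

section \<open>Continuity and measurability of matrix operations\<close>

lemma continuous_on_matrix_matrix_mult[continuous_intros]:
  fixes A :: "'a::topological_space \<Rightarrow> real^'n^'m" and B :: "'a \<Rightarrow> real^'k^'n"
  assumes "continuous_on T A" "continuous_on T B"
  shows "continuous_on T (\<lambda>x. A x ** B x)"
  unfolding matrix_matrix_mult_def by (intro continuous_intros assms)

lemma continuous_on_matrix_vector_mult[continuous_intros]:
  fixes A :: "'a::topological_space \<Rightarrow> real^'n^'m" and v :: "'a \<Rightarrow> real^'n"
  assumes "continuous_on T A" "continuous_on T v"
  shows "continuous_on T (\<lambda>x. A x *v v x)"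
  unfolding matrix_vector_mult_def by (intro continuous_intros assms)

lemma continuous_on_transpose[continuous_intros]:
  fixes A :: "'a::topological_space \<Rightarrow> real^'n^'m"
  assumes "continuous_on T A"
  shows "continuous_on T (\<lambda>x. transpose (A x))"
  unfolding transpose_def by (intro continuous_intros assms)

lemma borel_measurable_matrix_matrix_mult[measurable (raw)]:
  fixes A :: "'a \<Rightarrow> real^'n^'m" and B :: "'a \<Rightarrow> real^'k^'n"
  assumes "A \<in> borel_measurable M" "B \<in> borel_measurable M"
  shows "(\<lambda>x. A x ** B x) \<in> borel_measurable M"
  using assms by (rule borel_measurable_continuous_Pair) (intro continuous_intros)

lemma borel_measurable_matrix_vector_mult[measurable (raw)]:
  fixes A :: "'a \<Rightarrow> real^'n^'m" and v :: "'a \<Rightarrow> real^'n"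
  assumes "A \<in> borel_measurable M" "v \<in> borel_measurable M"
  shows "(\<lambda>x. A x *v v x) \<in> borel_measurable M"
  using assms by (rule borel_measurable_continuous_Pair) (intro continuous_intros)

lemma borel_measurable_transpose[measurable (raw)]:
  fixes A :: "'a \<Rightarrow> real^'n^'m"
  assumes "A \<in> borel_measurable M"
  shows "(\<lambda>x. transpose (A x)) \<in> borel_measurable M"
  by (rule measurable_compose[OF assms borel_measurable_continuous_onI]) (intro continuous_intros)

text \<open>The graph of \<open>pinv\<close> is closed, so preimages of compact sets are closed, although
  \<open>pinv\<close> itself is discontinuous where the rank drops.\<close>

lemma borel_measurable_pinv[measurable]:
  "(pinv :: real^'n^'m \<Rightarrow> real^'m^'n) \<in> borel_measurable borel"
proof -
  \<comment> \<open>Each equation equates continuous functions of the pair. The value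
    \<open>X\<close> comes first because the projection used below eliminates the first coordinate,
    over a compact set.\<close>
  have graph: "closed {(X, A :: real^'n^'m). penrose A X}"
    unfolding penrose_def case_prod_unfold
    by (intro closed_Collect_conj closed_Collect_eq continuous_intros)
  have "closed (pinv -` K)" if "compact K" for K :: "(real^'m^'n) set"
  proof -
    have "pinv -` K = {A. \<exists>X. X \<in> K \<and> (X, A) \<in> {(X, A). penrose A X}}"
      by (auto simp: pinv_eq_iff[symmetric])
    then show ?thesis
      using closed_compact_projection[OF that graph] by simp
  qed
  \<comment> \<open>Cutting a closed set with balls of growing radius writes its preimage as a
    countable union of closed sets.\<close>
  moreover have "pinv -` A = (\<Union>n. pinv -` (A \<inter> cball 0 (real n)))" for A :: "(real^'m^'n) set"
    by (auto simp: real_arch_simple)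
  ultimately have "pinv -` A \<in> sets borel" if "closed A" for A :: "(real^'m^'n) set"
    using that by (metis (no_types, lifting) borel_closed closed_Int_compact compact_cball
        sets.countable_UN image_subset_iff)
  then show ?thesis
    unfolding borel_eq_closed[where 'a = "real^'m^'n"] by (intro measurable_measure_of) auto
qed

section \<open>Positive semidefinite matrices\<close>

definition psd :: "real^'n^'n \<Rightarrow> bool" where
  "psd A \<longleftrightarrow> transpose A = A \<and> (\<forall>v. 0 \<le> v \<bullet> (A *v v))"

lemma psd_inner_commute: "psd A \<Longrightarrow> x \<bullet> (A *v y) = y \<bullet> (A *v x)"
  unfolding psd_def by (metis inner_matrix_vector inner_commute)

lemma psd_conjugate:
  assumes "psd A"
  shows "psd (B ** A ** transpose B)"
  unfolding psd_def
proof safe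
  show "transpose (B ** A ** transpose B) = B ** A ** transpose B"
    using assms by (simp add: psd_def matrix_transpose_mul matrix_mul_assoc)
  fix v
  have "v \<bullet> ((B ** A ** transpose B) *v v) = (transpose B *v v) \<bullet> (A *v (transpose B *v v))"
    by (simp add: inner_matrix_vector[of v B] del: transpose_matrix_vector flip: matrix_vector_mul_assoc)
  then show "0 \<le> v \<bullet> ((B ** A ** transpose B) *v v)"
    using assms by (simp add: psd_def)
qed

lemma psd_gram: "psd (transpose A ** A)"
proof -
  have "psd (mat 1)" by (simp add: psd_def)
  from psd_conjugate[OF this, of "transpose A"] show ?thesis by simp
qed

text \<open>The identity \<open>pinv A ** A ** pinv A = pinv A\<close>, with \<open>pinv A\<close>
  symmetric, exhibits the pseudoinverse as a congruence of \<open>A\<close>.\<close>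

lemma psd_pinv:
  assumes "psd A"
  shows "psd (pinv A)"
proof -
  have "transpose (pinv A) = pinv A"
    using assms by (simp add: psd_def transpose_pinv)
  with psd_conjugate[OF assms, of "pinv A"] show ?thesis
    by (simp add: pinv_mult_self)
qed

lemma mat_seminorm_power2: "psd A \<Longrightarrow> (mat_seminorm A v)\<^sup>2 = v \<bullet> (A *v v)"
  by (simp add: mat_seminorm_def psd_def)

subsection \<open>One step of the method\<close>

text \<open>Grouping \<open>DF F x ** S\<close> shows that the matrix under \<open>pinv\<close> is a
  Gram matrix, hence positive semidefinite.\<close>

lemma sketch_H_alt: "sketch_H F S x = S ** pinv (transpose (DF F x ** S) ** (DF F x ** S)) ** transpose S"
  by (simp add: sketch_H_def matrix_transpose_mul matrix_mul_assoc)

lemma psd_sketch_H: "psd (sketch_H F S x)"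
  unfolding sketch_H_alt by (intro psd_conjugate psd_pinv psd_gram)

text \<open>The inner factors \<open>transpose S\<close> and \<open>S\<close> of the two copies
  close up around the middle to the Gram matrix of \<open>DF F x ** S\<close>, which then stands
  between two copies of its pseudoinverse.\<close>

lemma sketch_H_gram: "sketch_H F S x ** (transpose (DF F x) ** DF F x) ** sketch_H F S x = sketch_H F S x"
proof -
  define P where "P = pinv (transpose (DF F x ** S) ** (DF F x ** S))"
  have P: "P ** (transpose (DF F x ** S) ** (DF F x ** S)) ** P = P"
    unfolding P_def by (rule pinv_mult_self)
  have H: "sketch_H F S x = S ** P ** transpose S"
    by (simp only: sketch_H_alt P_def)
  have "sketch_H F S x ** (transpose (DF F x) ** DF F x) ** sketch_H F S x
      = S ** (P ** (transpose (DF F x ** S) ** (DF F x ** S)) ** P) ** transpose S"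
    by (simp only: H matrix_transpose_mul matrix_mul_assoc)
  then show ?thesis
    by (simp only: P H)
qed

lemma f_sketch_eq: "f_sketch F S y x = 1/2 * (F x \<bullet> (sketch_H F S y *v F x))"
  by (simp add: f_sketch_def mat_seminorm_power2 psd_sketch_H)

lemma f_sketch_nonneg: "0 \<le> f_sketch F S y x"
  by (simp add: f_sketch_def)

lemma f_sketch_zero: "F x = 0 \<Longrightarrow> f_sketch F S y x = 0"
  by (simp add: f_sketch_eq)

lemma snr_step_eq: "snr_step F \<gamma> x S = x - \<gamma> *\<^sub>R (DF F x *v (sketch_H F S x *v F x))"
  by (simp add: snr_step_def sketch_H_def matrix_vector_mul_assoc matrix_mul_assoc)

text \<open>Collapsing the middle of the product by \<open>sketch_H_gram\<close> makes the quadratic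
  term of a step a multiple of the function value, so that the descent factor depends on \<gamma>
  alone.\<close>

lemma norm_snr_direction:
  "(norm (DF F x *v (sketch_H F S x *v F x)))\<^sup>2 = 2 * f_sketch F S x x"
proof -
  define H where "H = sketch_H F S x"
  have H: "transpose H = H"
    using psd_sketch_H[of F S x] by (simp add: psd_def H_def)
  have "(norm (DF F x *v (H *v F x)))\<^sup>2 = (H *v F x) \<bullet> (transpose (DF F x) *v (DF F x *v (H *v F x)))"
    by (simp add: power2_norm_eq_inner inner_matrix_vector del: transpose_matrix_vector)
  also have "\<dots> = F x \<bullet> (H *v (transpose (DF F x) *v (DF F x *v (H *v F x))))"
    by (simp add: inner_matrix_vector[of _ H] H del: transpose_matrix_vector)
  also have "\<dots> = F x \<bullet> (H *v F x)"
    using sketch_H_gram[of F S x, folded H_def]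
    by (simp add: matrix_vector_mul_assoc matrix_mul_assoc del: transpose_matrix_vector)
  finally show ?thesis
    by (simp add: f_sketch_eq H_def)
qed

lemma norm_snr_step:
  "(norm (snr_step F \<gamma> x S - xs))\<^sup>2 = (norm (x - xs))\<^sup>2
     - 2 * \<gamma> * ((DF F x *v (sketch_H F S x *v F x)) \<bullet> (x - xs)) + 2 * \<gamma>\<^sup>2 * f_sketch F S x x"
proof -
  define d where "d = DF F x *v (sketch_H F S x *v F x)"
  have "snr_step F \<gamma> x S - xs = (x - xs) - \<gamma> *\<^sub>R d"
    by (simp add: snr_step_eq d_def diff_diff_eq add.commute)
  moreover have "(norm (u - \<gamma> *\<^sub>R d))\<^sup>2 = (norm u)\<^sup>2 - 2 * \<gamma> * (d \<bullet> u) + \<gamma>\<^sup>2 * (norm d)\<^sup>2" for u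
    unfolding power2_norm_eq_inner
    by (simp add: inner_diff_left inner_diff_right inner_commute[of u d] power2_eq_square algebra_simps)
  ultimately show ?thesis
    by (simp only: d_def norm_snr_direction mult.assoc mult.left_commute)
qed

section \<open>Gradients and the pathwise descent\<close>

lemma gradient_eqI:
  assumes "GDERIV f x :> g"
  shows "gradient f x = g"
  unfolding gradient_def
proof (rule the_equality[where P = "\<lambda>g. GDERIV f x :> g", OF assms])
  fix g' assume "GDERIV f x :> g'"
  then have "(\<lambda>h. h \<bullet> g') = (\<lambda>h. h \<bullet> g)"
    using assms unfolding gderiv_def by (rule has_derivative_unique)
  then show "g' = g"
    by (metis vector_eq_ldot)
qed

text \<open>Symmetry of \<open>A\<close> makes both terms of the product rule equal, which cancels
  the factor 1/2. The matrix is constant, matching a sketched matrix frozen at \<open>y\<close>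
  while only \<open>F\<close> varies.\<close>

lemma gradient_quadratic:
  assumes F: "F differentiable (at x)" and A: "transpose A = A"
  shows "gradient (\<lambda>x. 1/2 * (F x \<bullet> (A *v F x))) x = DF F x *v (A *v F x)"
proof (rule gradient_eqI)
  have dF: "(F has_derivative (\<lambda>h. transpose (DF F x) *v h)) (at x)"
    using F jacobian_works[of F "at x"] by (simp add: DF_def del: transpose_matrix_vector)
  have "((\<lambda>x. 1/2 * (F x \<bullet> (A *v F x))) has_derivative
     (\<lambda>h. 1/2 * (F x \<bullet> (A *v (transpose (DF F x) *v h)) + (transpose (DF F x) *v h) \<bullet> (A *v F x)))) (at x)"
    by (intro has_derivative_mult_right has_derivative_inner
        bounded_linear.has_derivative[OF matrix_vector_mul_bounded_linear] dF)
  moreover have "1/2 * (F x \<bullet> (A *v (transpose (DF F x) *v h)) + (transpose (DF F x) *v h) \<bullet> (A *v F x))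
      = h \<bullet> (DF F x *v (A *v F x))" for h
  proof -
    have "F x \<bullet> (A *v (transpose (DF F x) *v h)) = (transpose (DF F x) *v h) \<bullet> (A *v F x)"
      by (metis A inner_matrix_vector inner_commute)
    then show ?thesis
      by (simp add: inner_matrix_vector[of h "DF F x"] del: transpose_matrix_vector)
  qed
  ultimately show "GDERIV (\<lambda>x. 1/2 * (F x \<bullet> (A *v F x))) x :> DF F x *v (A *v F x)"
    by (simp add: gderiv_def)
qed

lemma gradient_f_sketch:
  assumes "F differentiable (at x)"
  shows "gradient (f_sketch F S y) x = DF F x *v (sketch_H F S y *v F x)"
  using gradient_quadratic[OF assms, of "sketch_H F S y"] psd_sketch_H[of F S y]
  by (simp add: f_sketch_eq[abs_def] psd_def)

text \<open>The cross term contributes at most \<open>-2 * \<gamma>\<close> times the function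
  value, the quadratic term \<open>2 * \<gamma>\<^sup>2\<close> times it.\<close>

lemma snr_step_star:
  assumes F: "F differentiable (at x)" and star: "star_ineq (f_sketch F S x) x xs"
    and "F xs = 0" "0 < \<gamma>"
  shows "(norm (snr_step F \<gamma> x S - xs))\<^sup>2 \<le> (norm (x - xs))\<^sup>2 - 2 * \<gamma> * (1 - \<gamma>) * f_sketch F S x x"
proof -
  have "f_sketch F S x x \<le> (DF F x *v (sketch_H F S x *v F x)) \<bullet> (x - xs)"
    using star by (simp add: star_ineq_def f_sketch_zero[of F xs] assms(3) gradient_f_sketch[OF F] inner_diff_right)
  then have "2 * \<gamma> * f_sketch F S x x \<le> 2 * \<gamma> * ((DF F x *v (sketch_H F S x *v F x)) \<bullet> (x - xs))"
    using assms by simp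
  then show ?thesis
    unfolding norm_snr_step by (simp add: power2_eq_square algebra_simps)
qed

section \<open>Averaging over the sketch\<close>

text \<open>For fixed vectors this is a bounded linear functional of the matrix, so it commutes with
  the Bochner integral.\<close>

lemma expected_H_inner:
  assumes "integrable (D y) (\<lambda>S. sketch_H F S y)"
  shows "integrable (D y) (\<lambda>S. u \<bullet> (sketch_H F S y *v w))"
    and "(\<integral>S. u \<bullet> (sketch_H F S y *v w) \<partial>D y) = u \<bullet> (expected_H F D y *v w)"
proof -
  have "linear (\<lambda>A. u \<bullet> (A *v w))"
    by (rule linearI) (simp_all add: matrix_vector_mult_add_rdistrib inner_add_right
        flip: scaleR_matrix_vector_assoc)
  then have "bounded_linear (\<lambda>A. u \<bullet> (A *v w))"
    by (rule linear_conv_bounded_linear[THEN iffD1])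
  from integrable_bounded_linear[OF this assms] integral_bounded_linear[OF this assms]
  show "integrable (D y) (\<lambda>S. u \<bullet> (sketch_H F S y *v w))"
    and "(\<integral>S. u \<bullet> (sketch_H F S y *v w) \<partial>D y) = u \<bullet> (expected_H F D y *v w)"
    by (simp_all add: expected_H_def)
qed

text \<open>Symmetry and nonnegativity are tested on scalars that \<open>expected_H_inner\<close>
  carries through the integral.\<close>

lemma psd_expected_H:
  assumes "integrable (D y) (\<lambda>S. sketch_H F S y)"
  shows "psd (expected_H F D y)"
  unfolding psd_def
proof safe
  have "u \<bullet> (transpose (expected_H F D y) *v w) = u \<bullet> (expected_H F D y *v w)" for u w
  proof -
    have "u \<bullet> (transpose (expected_H F D y) *v w) = w \<bullet> (expected_H F D y *v u)"
      by (metis inner_matrix_vector inner_commute transpose_transpose)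
    also have "\<dots> = u \<bullet> (expected_H F D y *v w)"
      unfolding expected_H_inner(2)[where D = D and F = F and y = y, OF assms, symmetric]
      by (simp only: psd_inner_commute[OF psd_sketch_H])
    finally show ?thesis .
  qed
  then show "transpose (expected_H F D y) = expected_H F D y"
    unfolding matrix_eq by (metis vector_eq_ldot)
  show "0 \<le> v \<bullet> (expected_H F D y *v v)" for v
    unfolding expected_H_inner(2)[where D = D and F = F and y = y, OF assms, symmetric]
    by (intro Bochner_Integration.integral_nonneg) (use psd_sketch_H psd_def in blast)
qed

text \<open>Identifies the average of the quadratic forms with the form of the averaged matrix. The
  gradient of \<open>f_mean\<close> then comes from \<open>gradient_quadratic\<close>, avoiding
  differentiation under the integral.\<close>

lemma f_mean_eq:
  assumes "integrable (D y) (\<lambda>S. sketch_H F S y)"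
  shows "f_mean F D y x = 1/2 * (F x \<bullet> (expected_H F D y *v F x))"
  using expected_H_inner[where D = D and F = F and y = y, OF assms] by (simp add: f_mean_def f_sketch_eq)

lemma f_mean_eq_seminorm:
  assumes "integrable (D y) (\<lambda>S. sketch_H F S y)"
  shows "f_mean F D y x = 1/2 * (mat_seminorm (expected_H F D y) (F x))\<^sup>2"
  by (simp add: f_mean_eq[where D = D and F = F and y = y, OF assms] mat_seminorm_power2 psd_expected_H[where D = D and F = F and y = y, OF assms])

lemma f_mean_nonneg: "0 \<le> f_mean F D y x"
  unfolding f_mean_def by (intro Bochner_Integration.integral_nonneg f_sketch_nonneg)

lemma gradient_f_mean:
  assumes "F differentiable (at x)" and "integrable (D y) (\<lambda>S. sketch_H F S y)"
  shows "gradient (f_mean F D y) x = DF F x *v (expected_H F D y *v F x)"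
  using gradient_quadratic[OF assms(1), of "expected_H F D y"] psd_expected_H[where D = D and F = F and y = y, OF assms(2)]
  by (simp add: f_mean_eq[where D = D and F = F and y = y, OF assms(2), abs_def] psd_def)

text \<open>Once the quadratic term is collapsed, the squared distance is affine in the sketched
  matrix. Integrability of that matrix is therefore enough, and averaging replaces it by
  \<open>expected_H\<close>.\<close>

lemma expected_snr_step:
  assumes F: "F differentiable (at x)" and int: "integrable (D x) (\<lambda>S. sketch_H F S x)"
    and "prob_space (D x)"
    and star: "star_ineq (f_mean F D x) x xs" and "F xs = 0" "0 < \<gamma>"
  shows "integrable (D x) (\<lambda>S. (norm (snr_step F \<gamma> x S - xs))\<^sup>2)"
    and "(\<integral>S. (norm (snr_step F \<gamma> x S - xs))\<^sup>2 \<partial>D x)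
      \<le> (norm (x - xs))\<^sup>2 - 2 * \<gamma> * (1 - \<gamma>) * f_mean F D x x"
proof -
  interpret prob_space "D x" by fact
  \<comment> \<open>Moving \<open>DF F x\<close> to the other side gives the cross term the shape
    handled by \<open>expected_H_inner\<close>.\<close>
  define u where "u = transpose (DF F x) *v (x - xs)"
  have step: "(norm (snr_step F \<gamma> x S - xs))\<^sup>2 = (norm (x - xs))\<^sup>2
     - 2 * \<gamma> * (u \<bullet> (sketch_H F S x *v F x)) + \<gamma>\<^sup>2 * (F x \<bullet> (sketch_H F S x *v F x))" for S
    unfolding norm_snr_step f_sketch_eq u_def
    by (subst inner_commute) (simp add: inner_matrix_vector[of _ "DF F x"] del: transpose_matrix_vector)
  note H = expected_H_inner[where D = D and F = F and y = x, OF int]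
  show "integrable (D x) (\<lambda>S. (norm (snr_step F \<gamma> x S - xs))\<^sup>2)"
    unfolding step by (intro Bochner_Integration.integrable_add Bochner_Integration.integrable_diff
        integrable_const integrable_mult_right H)
  have "(\<integral>S. (norm (snr_step F \<gamma> x S - xs))\<^sup>2 \<partial>D x) = (norm (x - xs))\<^sup>2
     - 2 * \<gamma> * (u \<bullet> (expected_H F D x *v F x)) + \<gamma>\<^sup>2 * (F x \<bullet> (expected_H F D x *v F x))"
    unfolding step using H by (simp add: prob_space)
  also have "\<dots> = (norm (x - xs))\<^sup>2 - 2 * \<gamma> * (u \<bullet> (expected_H F D x *v F x)) + 2 * \<gamma>\<^sup>2 * f_mean F D x x"
    by (simp add: f_mean_eq[where D = D and F = F and y = x, OF int])
  also have "\<dots> \<le> (norm (x - xs))\<^sup>2 - 2 * \<gamma> * (1 - \<gamma>) * f_mean F D x x"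
  proof -
    have "u \<bullet> (expected_H F D x *v F x) = (DF F x *v (expected_H F D x *v F x)) \<bullet> (x - xs)"
      unfolding u_def by (simp add: inner_matrix_vector[of _ "DF F x"] inner_commute[of _ "x - xs"] del: transpose_matrix_vector)
    moreover have "f_mean F D x xs = 0"
      by (simp add: f_mean_eq[where D = D and F = F and y = x, OF int] \<open>F xs = 0\<close>)
    ultimately have "f_mean F D x x \<le> u \<bullet> (expected_H F D x *v F x)"
      using star by (simp add: star_ineq_def gradient_f_mean[where D = D and y = x, OF F int] inner_diff_right)
    then have "2 * \<gamma> * f_mean F D x x \<le> 2 * \<gamma> * (u \<bullet> (expected_H F D x *v F x))"
      using \<open>0 < \<gamma>\<close> by simp
    then show ?thesis
      by (simp add: power2_eq_square algebra_simps)
  qed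
  finally show "(\<integral>S. (norm (snr_step F \<gamma> x S - xs))\<^sup>2 \<partial>D x)
      \<le> (norm (x - xs))\<^sup>2 - 2 * \<gamma> * (1 - \<gamma>) * f_mean F D x x" .
qed

section \<open>Measurability of one step\<close>

lemma borel_measurable_continuously_differentiable:
  assumes "continuously_differentiable F"
  shows "F \<in> borel_measurable borel" "DF F \<in> borel_measurable borel"
proof -
  have "continuous_on UNIV F"
    using assms unfolding continuously_differentiable_def
    by (intro continuous_at_imp_continuous_on ballI differentiable_imp_continuous_within) simp
  moreover have "continuous_on UNIV (DF F)"
    using assms by (simp add: continuously_differentiable_def)
  ultimately show "F \<in> borel_measurable borel" "DF F \<in> borel_measurable borel"
    by (auto intro: borel_measurable_continuous_onI)
qed

lemma borel_measurable_sketch_H: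
  assumes F: "continuously_differentiable F"
    and [measurable]: "X \<in> borel_measurable M" "S \<in> borel_measurable M"
  shows "(\<lambda>\<omega>. sketch_H F (S \<omega>) (X \<omega>)) \<in> borel_measurable M"
proof -
  note borel_measurable_continuously_differentiable[OF F, measurable]
  show ?thesis unfolding sketch_H_def by measurable
qed

lemma borel_measurable_f_sketch:
  assumes F: "continuously_differentiable F"
    and [measurable]: "X \<in> borel_measurable M" "S \<in> borel_measurable M"
  shows "(\<lambda>\<omega>. f_sketch F (S \<omega>) (X \<omega>) (X \<omega>)) \<in> borel_measurable M"
proof -
  note borel_measurable_continuously_differentiable[OF F, measurable]
    borel_measurable_sketch_H[OF assms, measurable]
  show ?thesis unfolding f_sketch_eq by measurable
qed

lemma borel_measurable_snr_step:
  assumes F: "continuously_differentiable F"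
    and [measurable]: "X \<in> borel_measurable M" "S \<in> borel_measurable M"
  shows "(\<lambda>\<omega>. snr_step F \<gamma> (X \<omega>) (S \<omega>)) \<in> borel_measurable M"
proof -
  note borel_measurable_continuously_differentiable[OF F, measurable]
    borel_measurable_sketch_H[OF assms, measurable]
  show ?thesis unfolding snr_step_eq by measurable
qed

text \<open>Replacing the description \<open>gradient\<close> by its closed formula reduces this to
  measurable matrix expressions. It serves to transfer the star inequality from the distribution to
  the sketch actually drawn.\<close>

lemma pred_star_ineq_f_sketch:
  assumes F: "continuously_differentiable F"
    and [measurable]: "X \<in> borel_measurable M" "S \<in> borel_measurable M" and "F xs = 0"
  shows "Measurable.pred M (\<lambda>\<omega>. star_ineq (f_sketch F (S \<omega>) (X \<omega>)) (X \<omega>) xs)"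
proof -
  have diff: "F differentiable (at x)" for x
    using F by (simp add: continuously_differentiable_def)
  note borel_measurable_continuously_differentiable[OF F, measurable]
    borel_measurable_sketch_H[OF assms(1-3), measurable] borel_measurable_f_sketch[OF assms(1-3), measurable]
  show ?thesis
    unfolding star_ineq_def gradient_f_sketch[OF diff] f_sketch_zero[of F xs, OF \<open>F xs = 0\<close>] by measurable
qed

subsection \<open>Integration against a conditional distribution\<close>

text \<open>The two measures agree on measurable rectangles by the defining property of the
  conditional expectation.\<close>

lemma cond_distributed_distr:
  assumes "prob_space M" and G: "subalgebra M G" and Y: "cond_distributed M G N Y \<kappa>"
  shows "distr M (G \<Otimes>\<^sub>M N) (\<lambda>\<omega>. (\<omega>, Y \<omega>))
    = restr_to_subalg M G \<bind> (\<lambda>\<omega>. distr (\<kappa> \<omega>) (G \<Otimes>\<^sub>M N) (Pair \<omega>))"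
proof -
  interpret prob_space M by fact
  interpret finite_measure_subalgebra M G
    by standard (rule G)
  have Y_meas[measurable]: "Y \<in> measurable M N" and kernel: "\<kappa> \<in> measurable G (prob_algebra N)"
    and cond: "\<And>B. B \<in> sets N \<Longrightarrow>
      AE \<omega> in M. real_cond_exp M G (indicat_real (Y -` B \<inter> space M)) \<omega> = measure (\<kappa> \<omega>) B"
    using Y by (auto simp: cond_distributed_def)
  have sub[measurable]: "\<kappa> \<in> measurable G (subprob_algebra N)"
    using kernel by (rule measurable_prob_algebraD)
  have space: "space G = space M"
    using G by (simp add: subalgebra_def)
  have id_meas[measurable]: "(\<lambda>\<omega>. \<omega>) \<in> measurable M G"
    using G by (auto simp: measurable_def subalgebra_def)
  have \<kappa>: "prob_space (\<kappa> \<omega>)" "sets (\<kappa> \<omega>) = sets N" if "\<omega> \<in> space M" for \<omega>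
    using measurable_space[OF kernel] that by (auto simp: space space_prob_algebra)
  \<comment> \<open>\<open>?R\<close> is \<open>M\<close> restricted to the sets of
    \<open>G\<close>, for which the kernel is measurable; \<open>G\<close>-measurable integrands
    have the same integral under both.\<close>
  let ?R = "restr_to_subalg M G" and ?K = "\<lambda>\<omega>. distr (\<kappa> \<omega>) (G \<Otimes>\<^sub>M N) (Pair \<omega>)"
  let ?E = "{A \<times> B |A B. A \<in> sets G \<and> B \<in> sets N}"
  have K: "?K \<in> measurable G (subprob_algebra (G \<Otimes>\<^sub>M N))"
    by (rule measurable_distr2[OF _ sub]) simp
  then have KR: "?K \<in> measurable ?R (subprob_algebra (G \<Otimes>\<^sub>M N))"
    by (rule measurable_in_subalg[OF G])
  have ne: "space ?R \<noteq> {}"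
    by (simp add: space_restr_to_subalg not_empty)
  show ?thesis
  proof (rule measure_eqI_generator_eq[OF Int_stable_pair_measure_generator pair_measure_closed])
    show "sets (distr M (G \<Otimes>\<^sub>M N) (\<lambda>\<omega>. (\<omega>, Y \<omega>))) = sigma_sets (space G \<times> space N) ?E"
      by (simp add: sets_pair_measure)
    show "sets (?R \<bind> ?K) = sigma_sets (space G \<times> space N) ?E"
      using sets_bind[of ?R ?K "G \<Otimes>\<^sub>M N", OF _ ne] by (simp add: sets_pair_measure)
    show "range (\<lambda>i. space G \<times> space N) \<subseteq> ?E"
      by auto
    show "(\<Union>i::nat. space G \<times> space N) = space G \<times> space N"
      by simp
    show "emeasure (distr M (G \<Otimes>\<^sub>M N) (\<lambda>\<omega>. (\<omega>, Y \<omega>))) (space G \<times> space N) \<noteq> \<infinity>"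
      by (simp add: emeasure_distr)
    fix X assume "X \<in> ?E"
    then obtain A B where X: "X = A \<times> B" and A[measurable]: "A \<in> sets G" and B[measurable]: "B \<in> sets N"
      by auto
    have AM[measurable]: "A \<in> sets M"
      using A G by (auto simp: subalgebra_def)
    have int_ind: "integrable M (indicat_real (Y -` B \<inter> space M))"
      by (rule integrable_real_indicator[OF measurable_sets[OF Y_meas B]]) (simp add: emeasure_eq_measure)
    have "emeasure (?R \<bind> ?K) X = (\<integral>\<^sup>+\<omega>. emeasure (?K \<omega>) (A \<times> B) \<partial>?R)"
      unfolding X by (rule emeasure_bind[OF ne KR]) simp
    also have "\<dots> = (\<integral>\<^sup>+\<omega>. emeasure (?K \<omega>) (A \<times> B) \<partial>M)"
      by (rule nn_integral_subalgebra2[OF G measurable_emeasure_kernel[OF K]]) simp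
    \<comment> \<open>The section of the rectangle at \<omega> is \<open>B\<close> if \<omega> lies
      in \<open>A\<close> and empty otherwise.\<close>
    also have "\<dots> = (\<integral>\<^sup>+\<omega>. ennreal (indicator A \<omega> * measure (\<kappa> \<omega>) B) \<partial>M)"
    proof (rule nn_integral_cong)
      fix \<omega> assume \<omega>: "\<omega> \<in> space M"
      interpret \<kappa>: prob_space "\<kappa> \<omega>" using \<kappa>[OF \<omega>] by simp
      have "Pair \<omega> \<in> measurable (\<kappa> \<omega>) (G \<Otimes>\<^sub>M N)"
        using \<omega> measurable_Pair1'[of \<omega> G N] measurable_cong_sets[OF \<kappa>(2)[OF \<omega>] refl] by (simp add: space)
      then have "emeasure (?K \<omega>) (A \<times> B) = emeasure (\<kappa> \<omega>) (Pair \<omega> -` (A \<times> B) \<inter> space (\<kappa> \<omega>))"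
        by (simp add: emeasure_distr)
      also have "Pair \<omega> -` (A \<times> B) \<inter> space (\<kappa> \<omega>) = (if \<omega> \<in> A then B else {})"
        using sets.sets_into_space[OF B] sets_eq_imp_space_eq[OF \<kappa>(2)[OF \<omega>]] by auto
      finally show "emeasure (?K \<omega>) (A \<times> B) = ennreal (indicator A \<omega> * measure (\<kappa> \<omega>) B)"
        by (simp add: \<kappa>.emeasure_eq_measure)
    qed
    \<comment> \<open>The kernel is exchanged for the conditional probability; since
      \<open>A\<close> belongs to \<open>G\<close>, integrating over \<open>A\<close> will then
      remove the conditioning.\<close>
    also have "\<dots> = (\<integral>\<^sup>+\<omega>. ennreal (indicator A \<omega> * real_cond_exp M G (indicat_real (Y -` B \<inter> space M)) \<omega>) \<partial>M)"
      using cond[OF B] by (intro nn_integral_cong_AE) auto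
    also have "\<dots> = ennreal (\<integral>\<omega>\<in>A. real_cond_exp M G (indicat_real (Y -` B \<inter> space M)) \<omega> \<partial>M)"
      unfolding set_lebesgue_integral_def real_scaleR_def
    proof (rule nn_integral_eq_integral)
      show "integrable M (\<lambda>\<omega>. indicat_real A \<omega> * real_cond_exp M G (indicat_real (Y -` B \<inter> space M)) \<omega>)"
        using integrable_mult_indicator[OF AM real_cond_exp_int(1)[OF int_ind]] by simp
      show "AE \<omega> in M. 0 \<le> indicat_real A \<omega> * real_cond_exp M G (indicat_real (Y -` B \<inter> space M)) \<omega>"
        using cond[OF B] by eventually_elim simp
    qed
    also have "\<dots> = ennreal (\<integral>\<omega>\<in>A. indicat_real (Y -` B \<inter> space M) \<omega> \<partial>M)"
      by (simp only: real_cond_exp_intA[OF int_ind A])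
    also have "\<dots> = emeasure M (A \<inter> (Y -` B \<inter> space M))"
      unfolding set_lebesgue_integral_def
      by (simp add: emeasure_eq_measure flip: indicator_inter_arith)
    also have "A \<inter> (Y -` B \<inter> space M) = (\<lambda>\<omega>. (\<omega>, Y \<omega>)) -` X \<inter> space M"
      by (auto simp: X)
    also have "emeasure M \<dots> = emeasure (distr M (G \<Otimes>\<^sub>M N) (\<lambda>\<omega>. (\<omega>, Y \<omega>))) X"
      by (subst emeasure_distr) (simp_all add: X)
    finally show "emeasure (distr M (G \<Otimes>\<^sub>M N) (\<lambda>\<omega>. (\<omega>, Y \<omega>))) X = emeasure (?R \<bind> ?K) X" ..
  qed
qed

text \<open>Disintegration of the joint law just computed. The nonnegative form can be applied
  before the iterates are known to have finite second moments.\<close>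

lemma nn_integral_cond_distributed:
  assumes "prob_space M" and G: "subalgebra M G" and Y: "cond_distributed M G N Y \<kappa>"
    and f[measurable]: "f \<in> borel_measurable (G \<Otimes>\<^sub>M N)"
  shows "(\<integral>\<^sup>+\<omega>. f (\<omega>, Y \<omega>) \<partial>M) = (\<integral>\<^sup>+\<omega>. \<integral>\<^sup>+y. f (\<omega>, y) \<partial>\<kappa> \<omega> \<partial>M)"
proof -
  have [measurable]: "Y \<in> measurable M N" and kernel: "\<kappa> \<in> measurable G (prob_algebra N)"
    using Y by (auto simp: cond_distributed_def)
  have sub[measurable]: "\<kappa> \<in> measurable G (subprob_algebra N)"
    using kernel by (rule measurable_prob_algebraD)
  have space: "space G = space M"
    using G by (simp add: subalgebra_def)
  have [measurable]: "(\<lambda>\<omega>. \<omega>) \<in> measurable M G"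
    using G by (auto simp: measurable_def subalgebra_def)
  have K: "(\<lambda>\<omega>. distr (\<kappa> \<omega>) (G \<Otimes>\<^sub>M N) (Pair \<omega>)) \<in> measurable G (subprob_algebra (G \<Otimes>\<^sub>M N))"
    by (rule measurable_distr2[OF _ sub]) simp
  have "(\<integral>\<^sup>+\<omega>. f (\<omega>, Y \<omega>) \<partial>M) = (\<integral>\<^sup>+p. f p \<partial>distr M (G \<Otimes>\<^sub>M N) (\<lambda>\<omega>. (\<omega>, Y \<omega>)))"
    by (simp add: nn_integral_distr)
  also have "\<dots> = (\<integral>\<^sup>+\<omega>. \<integral>\<^sup>+p. f p \<partial>distr (\<kappa> \<omega>) (G \<Otimes>\<^sub>M N) (Pair \<omega>) \<partial>restr_to_subalg M G)"
    unfolding cond_distributed_distr[OF assms(1-3)]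
    by (rule nn_integral_bind[OF f measurable_in_subalg[OF G K]])
  also have "\<dots> = (\<integral>\<^sup>+\<omega>. \<integral>\<^sup>+p. f p \<partial>distr (\<kappa> \<omega>) (G \<Otimes>\<^sub>M N) (Pair \<omega>) \<partial>M)"
    by (intro nn_integral_subalgebra2[OF G] measurable_compose[OF K]
        nn_integral_measurable_subprob_algebra f)
  also have "\<dots> = (\<integral>\<^sup>+\<omega>. \<integral>\<^sup>+y. f (\<omega>, y) \<partial>\<kappa> \<omega> \<partial>M)"
  proof (rule nn_integral_cong)
    fix \<omega> assume \<omega>: "\<omega> \<in> space M"
    then have "Pair \<omega> \<in> measurable (\<kappa> \<omega>) (G \<Otimes>\<^sub>M N)"
      using measurable_Pair1'[of \<omega> G N] measurable_space[OF kernel, of \<omega>]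
        measurable_cong_sets[of "\<kappa> \<omega>" N] by (simp add: space space_prob_algebra)
    then show "(\<integral>\<^sup>+p. f p \<partial>distr (\<kappa> \<omega>) (G \<Otimes>\<^sub>M N) (Pair \<omega>)) = (\<integral>\<^sup>+y. f (\<omega>, y) \<partial>\<kappa> \<omega>)"
      by (simp add: nn_integral_distr)
  qed
  finally show ?thesis .
qed

text \<open>Disintegration applied to the indicator of the exceptional set shows that this set has
  measure zero.\<close>

lemma AE_cond_distributed:
  assumes "prob_space M" and G: "subalgebra M G" and Y: "cond_distributed M G N Y \<kappa>"
    and P[measurable]: "Measurable.pred (G \<Otimes>\<^sub>M N) (\<lambda>(\<omega>, y). P \<omega> y)"
    and AE: "AE \<omega> in M. AE y in \<kappa> \<omega>. P \<omega> y"
  shows "AE \<omega> in M. P \<omega> (Y \<omega>)"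
proof -
  have [measurable]: "Y \<in> measurable M N"
    using Y by (simp add: cond_distributed_def)
  have [measurable]: "(\<lambda>\<omega>. \<omega>) \<in> measurable M G"
    using G by (auto simp: measurable_def subalgebra_def)
  let ?f = "\<lambda>(\<omega>, y). if P \<omega> y then 0 else 1 :: ennreal"
  have f[measurable]: "?f \<in> borel_measurable (G \<Otimes>\<^sub>M N)"
    unfolding case_prod_unfold using P by (simp add: case_prod_unfold)
  have "(\<integral>\<^sup>+\<omega>. ?f (\<omega>, Y \<omega>) \<partial>M) = (\<integral>\<^sup>+\<omega>. \<integral>\<^sup>+y. ?f (\<omega>, y) \<partial>\<kappa> \<omega> \<partial>M)"
    by (rule nn_integral_cond_distributed[OF assms(1-3) f])
  also have "\<dots> = (\<integral>\<^sup>+\<omega>. 0 \<partial>M)"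
  proof (rule nn_integral_cong_AE)
    show "AE \<omega> in M. (\<integral>\<^sup>+y. ?f (\<omega>, y) \<partial>\<kappa> \<omega>) = 0"
      using AE
    proof eventually_elim
      case (elim \<omega>)
      then have "(\<integral>\<^sup>+y. ?f (\<omega>, y) \<partial>\<kappa> \<omega>) = (\<integral>\<^sup>+y. 0 \<partial>\<kappa> \<omega>)"
        by (intro nn_integral_cong_AE) auto
      then show ?case by simp
    qed
  qed
  finally have "(\<integral>\<^sup>+\<omega>. ?f (\<omega>, Y \<omega>) \<partial>M) = 0"
    by simp
  then have "AE \<omega> in M. ?f (\<omega>, Y \<omega>) = 0"
    by (subst (asm) nn_integral_0_iff_AE) (auto intro!: measurable_compose[OF _ f])
  then show ?thesis
    by eventually_elim (auto split: if_splits)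
qed

subsection \<open>The iterates\<close>

lemma space_history: "space (history M S k) = space M"
  by (simp add: history_def)

lemma measurable_history: "i < k \<Longrightarrow> S i \<in> borel_measurable (history M S k)"
proof -
  assume "i < k"
  have "(\<lambda>\<omega>. \<lambda>i\<in>{..<k}. S i \<omega>) \<in> measurable (history M S k) (\<Pi>\<^sub>M i\<in>{..<k}. borel)"
    unfolding history_def by (rule measurable_vimage_algebra1) (auto simp: space_PiM)
  from measurable_compose[OF this measurable_component_singleton[of i]] \<open>i < k\<close>
  show ?thesis by simp
qed

lemma subalgebra_history:
  assumes [measurable]: "\<And>i. S i \<in> borel_measurable M"
  shows "subalgebra M (history M S k)"
proof -
  have "(\<lambda>\<omega>. \<lambda>i\<in>{..<k}. S i \<omega>) \<in> measurable M (\<Pi>\<^sub>M i\<in>{..<k}. borel)"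
    by measurable
  then show ?thesis
    by (simp add: subalgebra_def history_def measurable_iff_sets)
qed

text \<open>Collects the setting shared by both kinds of convergence statement; the two star
  inequalities remain explicit premises of the lemmas that use them.\<close>

locale snr =
  fixes F :: "real^'p \<Rightarrow> real^'m"
    and D :: "real^'p \<Rightarrow> (real^'t^'m) measure"
    and M :: "'w measure"
    and S :: "nat \<Rightarrow> 'w \<Rightarrow> real^'t^'m"
    and X :: "nat \<Rightarrow> 'w \<Rightarrow> real^'p"
    and x0 xs :: "real^'p"
    and \<gamma> :: real
  assumes F: "continuously_differentiable F"
    and D: "sketch_distributions F D"
    and process: "snr_process M F D \<gamma> x0 S X"
    and \<gamma>: "0 < \<gamma>" "\<gamma> < 1"
    and root: "F xs = 0"
begin

lemma diff_F: "F differentiable (at x)"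
  using F by (simp add: continuously_differentiable_def)

lemma prob_D: "prob_space (D y)"
  and sets_D: "sets (D y) = sets borel"
  and integrable_sketch_H: "integrable (D y) (\<lambda>S. sketch_H F S y)"
  using D by (auto simp: sketch_distributions_def)

lemma prob_M: "prob_space M"
  and X_0: "\<omega> \<in> space M \<Longrightarrow> X 0 \<omega> = x0"
  and X_Suc: "\<omega> \<in> space M \<Longrightarrow> X (Suc k) \<omega> = snr_step F \<gamma> (X k \<omega>) (S k \<omega>)"
  and cond_S: "cond_distributed M (history M S k) borel (S k) (\<lambda>\<omega>. D (X k \<omega>))"
  using process by (auto simp: snr_process_def)

lemma S_measurable[measurable]: "S k \<in> borel_measurable M"
  using cond_S[of k] by (simp add: cond_distributed_def)

lemma kernel: "(\<lambda>\<omega>. D (X k \<omega>)) \<in> measurable (history M S k) (subprob_algebra borel)"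
  using cond_S[of k] by (auto simp: cond_distributed_def intro: measurable_prob_algebraD)

lemma sub: "subalgebra M (history M S k)"
  by (rule subalgebra_history) measurable

text \<open>\<open>X 0\<close> is constant, and \<open>X (Suc k)\<close> uses only
  \<open>X k\<close> and \<open>S k\<close>; with \<open>Suc k \<le> n\<close> the index
  \<open>k\<close> still lies in the history up to \<open>n\<close>.\<close>

lemma X_adapted: "k \<le> n \<Longrightarrow> X k \<in> borel_measurable (history M S n)"
proof (induction k)
  case 0
  have "X 0 \<in> borel_measurable (history M S n) \<longleftrightarrow> (\<lambda>\<omega>. x0) \<in> borel_measurable (history M S n)"
    by (rule measurable_cong) (simp add: space_history X_0)
  then show ?case by simp
next
  case (Suc k)
  have "X (Suc k) \<in> borel_measurable (history M S n) \<longleftrightarrow>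
      (\<lambda>\<omega>. snr_step F \<gamma> (X k \<omega>) (S k \<omega>)) \<in> borel_measurable (history M S n)"
    by (rule measurable_cong) (simp add: space_history X_Suc)
  then show ?case
    using Suc borel_measurable_snr_step[OF F _ measurable_history, of "X k" M S n k] by simp
qed

lemma X_measurable[measurable]: "X k \<in> borel_measurable M"
  using measurable_from_subalg[OF sub X_adapted[OF order_refl]] .

abbreviation V :: "nat \<Rightarrow> 'w \<Rightarrow> real" where
  "V k \<omega> \<equiv> (norm (X k \<omega> - xs))\<^sup>2"

abbreviation h :: "nat \<Rightarrow> 'w \<Rightarrow> real" where
  "h k \<omega> \<equiv> f_mean F D (X k \<omega>) (X k \<omega>)"

lemma h_measurable[measurable]: "h k \<in> borel_measurable M"
proof (rule measurable_from_subalg[OF sub])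
  have [measurable]: "X k \<in> borel_measurable (history M S k)"
    by (rule X_adapted) simp
  \<comment> \<open>The measure of integration varies with \<omega>, so the integral is rewritten as
    a nonnegative one, to which measurability of integrals along a kernel applies.\<close>
  have "h k \<omega> = enn2real (\<integral>\<^sup>+s. f_sketch F s (X k \<omega>) (X k \<omega>) \<partial>D (X k \<omega>))" for \<omega>
    unfolding f_mean_def
    by (intro integral_eq_nn_integral borel_measurable_f_sketch[OF F])
       (simp_all add: f_sketch_nonneg measurable_ident_sets[OF sets_D])
  moreover have "(\<lambda>\<omega>. \<integral>\<^sup>+s. f_sketch F s (X k \<omega>) (X k \<omega>) \<partial>D (X k \<omega>)) \<in> borel_measurable (history M S k)"
  proof (rule nn_integral_measurable_subprob_algebra2[OF _ kernel])
    have "(\<lambda>p. f_sketch F (snd p) (X k (fst p)) (X k (fst p))) \<in> borel_measurable (history M S k \<Otimes>\<^sub>M borel)"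
      by (rule borel_measurable_f_sketch[OF F]) measurable
    then show "(\<lambda>(\<omega>, s). ennreal (f_sketch F s (X k \<omega>) (X k \<omega>))) \<in> borel_measurable (history M S k \<Otimes>\<^sub>M borel)"
      unfolding case_prod_unfold by measurable
  qed
  ultimately show "h k \<in> borel_measurable (history M S k)"
    by simp
qed

lemma decrement_nonneg: "0 \<le> 2 * \<gamma> * (1 - \<gamma>) * h k \<omega>"
  using \<gamma> by (intro mult_nonneg_nonneg f_mean_nonneg) auto

lemma nn_integral_V_Suc:
  "(\<integral>\<^sup>+\<omega>. V (Suc k) \<omega> \<partial>M)
    = (\<integral>\<^sup>+\<omega>. \<integral>\<^sup>+s. (norm (snr_step F \<gamma> (X k \<omega>) s - xs))\<^sup>2 \<partial>D (X k \<omega>) \<partial>M)"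
proof -
  let ?f = "\<lambda>p. ennreal ((norm (snr_step F \<gamma> (X k (fst p)) (snd p) - xs))\<^sup>2)"
  have [measurable]: "X k \<in> borel_measurable (history M S k)"
    by (rule X_adapted) simp
  have [measurable]: "(\<lambda>p. snr_step F \<gamma> (X k (fst p)) (snd p)) \<in> borel_measurable (history M S k \<Otimes>\<^sub>M borel)"
    by (rule borel_measurable_snr_step[OF F]) measurable
  have "?f \<in> borel_measurable (history M S k \<Otimes>\<^sub>M borel)"
    by measurable
  from nn_integral_cond_distributed[OF prob_M sub cond_S this]
  have "(\<integral>\<^sup>+\<omega>. (norm (snr_step F \<gamma> (X k \<omega>) (S k \<omega>) - xs))\<^sup>2 \<partial>M)
    = (\<integral>\<^sup>+\<omega>. \<integral>\<^sup>+s. (norm (snr_step F \<gamma> (X k \<omega>) s - xs))\<^sup>2 \<partial>D (X k \<omega>) \<partial>M)"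
    by simp
  moreover have "(\<integral>\<^sup>+\<omega>. V (Suc k) \<omega> \<partial>M) = (\<integral>\<^sup>+\<omega>. (norm (snr_step F \<gamma> (X k \<omega>) (S k \<omega>) - xs))\<^sup>2 \<partial>M)"
    by (rule nn_integral_cong) (simp add: X_Suc)
  ultimately show ?thesis by simp
qed

text \<open>The additive form avoids truncated subtraction in \<open>ennreal\<close> and makes sense
  before finiteness is known.\<close>

lemma nn_integral_descent:
  assumes star: "AE \<omega> in M. \<forall>k. star_ineq (f_mean F D (X k \<omega>)) (X k \<omega>) xs"
  shows "(\<integral>\<^sup>+\<omega>. V (Suc k) \<omega> \<partial>M) + (\<integral>\<^sup>+\<omega>. 2 * \<gamma> * (1 - \<gamma>) * h k \<omega> \<partial>M) \<le> (\<integral>\<^sup>+\<omega>. V k \<omega> \<partial>M)"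
proof -
  let ?I = "\<lambda>\<omega>. \<integral>\<^sup>+s. (norm (snr_step F \<gamma> (X k \<omega>) s - xs))\<^sup>2 \<partial>D (X k \<omega>)"
  let ?c = "2 * \<gamma> * (1 - \<gamma>)"
  have "(\<integral>\<^sup>+\<omega>. V (Suc k) \<omega> \<partial>M) + (\<integral>\<^sup>+\<omega>. ?c * h k \<omega> \<partial>M)
      = (\<integral>\<^sup>+\<omega>. ?I \<omega> + ennreal (?c * h k \<omega>) \<partial>M)"
    unfolding nn_integral_V_Suc
  proof (rule nn_integral_add[symmetric])
    have [measurable]: "X k \<in> borel_measurable (history M S k)"
      by (rule X_adapted) simp
    have [measurable]: "(\<lambda>p. snr_step F \<gamma> (X k (fst p)) (snd p)) \<in> borel_measurable (history M S k \<Otimes>\<^sub>M borel)"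
      by (rule borel_measurable_snr_step[OF F]) measurable
    show "?I \<in> borel_measurable M"
      by (rule measurable_from_subalg[OF sub nn_integral_measurable_subprob_algebra2[OF _ kernel]])
         (simp add: case_prod_unfold)
  qed measurable
  also have "\<dots> \<le> (\<integral>\<^sup>+\<omega>. V k \<omega> \<partial>M)"
  proof (rule nn_integral_mono_AE)
    show "AE \<omega> in M. ?I \<omega> + ennreal (?c * h k \<omega>) \<le> V k \<omega>"
      using star
    proof eventually_elim
      case (elim \<omega>)
      note step = expected_snr_step[where F = F and D = D and x = "X k \<omega>" and xs = xs and \<gamma> = \<gamma>,
          OF diff_F integrable_sketch_H prob_D spec[OF elim] root \<gamma>(1)]
      \<comment> \<open>The conditional second moment is finite, so the comparison can be made among
        real numbers.\<close>
      have "?I \<omega> = ennreal (\<integral>s. (norm (snr_step F \<gamma> (X k \<omega>) s - xs))\<^sup>2 \<partial>D (X k \<omega>))"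
        by (rule nn_integral_eq_integral[OF step(1)]) simp
      also have "\<dots> + ennreal (?c * h k \<omega>)
          = ennreal ((\<integral>s. (norm (snr_step F \<gamma> (X k \<omega>) s - xs))\<^sup>2 \<partial>D (X k \<omega>)) + ?c * h k \<omega>)"
        using decrement_nonneg by (intro ennreal_plus[symmetric] Bochner_Integration.integral_nonneg) auto
      also have "\<dots> \<le> ennreal (V k \<omega>)"
        using step(2) by (intro ennreal_leI) simp
      finally show ?case .
    qed
  qed
  finally show ?thesis .
qed

text \<open>Finiteness propagates: the squared distance starts as a constant, and each descent
  bounds both the next expected distance and the expected decrement by the current one. The
  inequality then passes to real integrals.\<close>

lemma
  assumes star: "AE \<omega> in M. \<forall>k. star_ineq (f_mean F D (X k \<omega>)) (X k \<omega>) xs"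
  shows integrable_V: "integrable M (V k)"
    and integrable_h: "integrable M (h k)"
    and descent: "(\<integral>\<omega>. V (Suc k) \<omega> \<partial>M) + 2 * \<gamma> * (1 - \<gamma>) * (\<integral>\<omega>. h k \<omega> \<partial>M) \<le> (\<integral>\<omega>. V k \<omega> \<partial>M)"
proof -
  interpret prob_space M by (rule prob_M)
  let ?c = "2 * \<gamma> * (1 - \<gamma>)"
  note nnd = nn_integral_descent[OF star]
  have fin: "(\<integral>\<^sup>+\<omega>. V k \<omega> \<partial>M) < \<infinity>" for k
  proof (induction k)
    case 0
    have "(\<integral>\<^sup>+\<omega>. V 0 \<omega> \<partial>M) = (\<integral>\<^sup>+\<omega>. (norm (x0 - xs))\<^sup>2 \<partial>M)"
      by (rule nn_integral_cong) (simp add: X_0)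
    then show ?case by (simp add: emeasure_space_1)
  next
    case (Suc k)
    have "(\<integral>\<^sup>+\<omega>. V (Suc k) \<omega> \<partial>M) \<le> (\<integral>\<^sup>+\<omega>. V (Suc k) \<omega> \<partial>M) + (\<integral>\<^sup>+\<omega>. ?c * h k \<omega> \<partial>M)"
      by simp
    then show ?case using nnd[of k] Suc by (meson le_less_trans)
  qed
  have intV: "integrable M (V k)" for k
    by (rule integrableI_nonneg) (use fin in auto)
  have "(\<integral>\<^sup>+\<omega>. ?c * h k \<omega> \<partial>M) \<le> (\<integral>\<^sup>+\<omega>. V (Suc k) \<omega> \<partial>M) + (\<integral>\<^sup>+\<omega>. ?c * h k \<omega> \<partial>M)"
    by simp
  then have "(\<integral>\<^sup>+\<omega>. ?c * h k \<omega> \<partial>M) < \<infinity>"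
    using nnd[of k] fin[of k] by (meson le_less_trans)
  then have intc: "integrable M (\<lambda>\<omega>. ?c * h k \<omega>)"
    by (intro integrableI_nonneg) (use decrement_nonneg in auto)
  then show "integrable M (h k)"
    using \<gamma> by auto
  have "ennreal ((\<integral>\<omega>. V (Suc k) \<omega> \<partial>M) + (\<integral>\<omega>. ?c * h k \<omega> \<partial>M))
      = ennreal (\<integral>\<omega>. V (Suc k) \<omega> \<partial>M) + ennreal (\<integral>\<omega>. ?c * h k \<omega> \<partial>M)"
    using decrement_nonneg by (intro ennreal_plus Bochner_Integration.integral_nonneg) auto
  also have "\<dots> \<le> ennreal (\<integral>\<omega>. V k \<omega> \<partial>M)"
    using nnd[of k] decrement_nonneg
    by (simp add: nn_integral_eq_integral[OF intV] nn_integral_eq_integral[OF intc])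
  finally show "(\<integral>\<omega>. V (Suc k) \<omega> \<partial>M) + ?c * (\<integral>\<omega>. h k \<omega> \<partial>M) \<le> (\<integral>\<omega>. V k \<omega> \<partial>M)"
    by (subst (asm) ennreal_le_iff) (auto intro: Bochner_Integration.integral_nonneg)
  show "integrable M (V k)" by (rule intV)
qed

lemma sum_descent:
  assumes star: "AE \<omega> in M. \<forall>k. star_ineq (f_mean F D (X k \<omega>)) (X k \<omega>) xs"
  shows "(\<Sum>t<k. \<integral>\<omega>. h t \<omega> \<partial>M) \<le> (norm (x0 - xs))\<^sup>2 / (2 * \<gamma> * (1 - \<gamma>))"
proof -
  interpret prob_space M by (rule prob_M)
  let ?c = "2 * \<gamma> * (1 - \<gamma>)"
  \<comment> \<open>The last distance is kept so that the telescoping induction closes; being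
    nonnegative, it is dropped afterwards.\<close>
  have "(\<integral>\<omega>. V k \<omega> \<partial>M) + ?c * (\<Sum>t<k. \<integral>\<omega>. h t \<omega> \<partial>M) \<le> (norm (x0 - xs))\<^sup>2"
  proof (induction k)
    case 0
    have "(\<integral>\<omega>. V 0 \<omega> \<partial>M) = (\<integral>\<omega>. (norm (x0 - xs))\<^sup>2 \<partial>M)"
      by (rule Bochner_Integration.integral_cong) (simp_all add: X_0)
    then show ?case by (simp add: prob_space)
  next
    case (Suc k)
    then show ?case
      using descent[OF star, of k] by (simp add: distrib_left)
  qed
  moreover have "0 \<le> (\<integral>\<omega>. V k \<omega> \<partial>M)"
    by (simp add: Bochner_Integration.integral_nonneg)
  ultimately have "?c * (\<Sum>t<k. \<integral>\<omega>. h t \<omega> \<partial>M) \<le> (norm (x0 - xs))\<^sup>2"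
    by linarith
  then show ?thesis
    using \<gamma> by (simp add: pos_le_divide_eq mult.commute)
qed

text \<open>The minimum lies below each of the \<open>k\<close> terms, hence below their average.
  Since \<open>k\<close> is at least 1, the index set is nonempty and \<open>h 0\<close> dominates
  the minimum.\<close>

lemma
  assumes star: "AE \<omega> in M. \<forall>k. star_ineq (f_mean F D (X k \<omega>)) (X k \<omega>) xs" and "1 \<le> k"
  shows integrable_Min_h: "integrable M (\<lambda>\<omega>. MIN t\<in>{..<k}. h t \<omega>)"
    and Min_h_le: "(\<integral>\<omega>. (MIN t\<in>{..<k}. h t \<omega>) \<partial>M) \<le> 1 / real k * (\<Sum>t<k. \<integral>\<omega>. h t \<omega> \<partial>M)"
proof -
  have le: "(MIN t\<in>{..<k}. h t \<omega>) \<le> h t \<omega>" if "t < k" for t \<omega>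
    using that by (intro Min_le) auto
  have nonneg: "0 \<le> (MIN t\<in>{..<k}. h t \<omega>)" for \<omega>
    using \<open>1 \<le> k\<close> f_mean_nonneg by (subst Min_ge_iff) (auto simp: lessThan_empty_iff)
  show int: "integrable M (\<lambda>\<omega>. MIN t\<in>{..<k}. h t \<omega>)"
  proof (rule Bochner_Integration.integrable_bound[OF integrable_h[OF star, of 0]])
    show "AE \<omega> in M. norm (MIN t\<in>{..<k}. h t \<omega>) \<le> norm (h 0 \<omega>)"
      using nonneg le[of 0] \<open>1 \<le> k\<close> by (intro AE_I2) (simp add: f_mean_nonneg)
  qed measurable
  have "real k * (\<integral>\<omega>. (MIN t\<in>{..<k}. h t \<omega>) \<partial>M) = (\<Sum>t<k. \<integral>\<omega>. (MIN t\<in>{..<k}. h t \<omega>) \<partial>M)"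
    by simp
  also have "\<dots> \<le> (\<Sum>t<k. \<integral>\<omega>. h t \<omega> \<partial>M)"
    by (intro sum_mono Bochner_Integration.integral_mono int integrable_h[OF star] le) simp
  finally show "(\<integral>\<omega>. (MIN t\<in>{..<k}. h t \<omega>) \<partial>M) \<le> 1 / real k * (\<Sum>t<k. \<integral>\<omega>. h t \<omega> \<partial>M)"
    using \<open>1 \<le> k\<close> by (simp add: pos_le_divide_eq mult.commute)
qed

text \<open>The hypothesis speaks of almost every sketch under the current distribution, the
  iteration of the drawn \<open>S k\<close>; \<open>AE_cond_distributed\<close> bridges the two.
  Countably many indices leave one null set, off which the descent is iterated pathwise.\<close>

lemma norm_iterates_le:
  assumes star: "AE \<omega> in M. \<forall>k. AE s in D (X k \<omega>). star_ineq (f_sketch F s (X k \<omega>)) (X k \<omega>) xs"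
  shows "AE \<omega> in M. \<forall>k. norm (X k \<omega> - xs) \<le> norm (x0 - xs)"
proof -
  have "AE \<omega> in M. star_ineq (f_sketch F (S k \<omega>) (X k \<omega>)) (X k \<omega>) xs" for k
  proof (rule AE_cond_distributed[OF prob_M sub cond_S])
    have [measurable]: "X k \<in> borel_measurable (history M S k)"
      by (rule X_adapted) simp
    show "Measurable.pred (history M S k \<Otimes>\<^sub>M borel)
        (\<lambda>(\<omega>, s). star_ineq (f_sketch F s (X k \<omega>)) (X k \<omega>) xs)"
      unfolding case_prod_unfold by (rule pred_star_ineq_f_sketch[OF F _ _ root]) measurable
    show "AE \<omega> in M. AE s in D (X k \<omega>). star_ineq (f_sketch F s (X k \<omega>)) (X k \<omega>) xs"
      using star by eventually_elim simp
  qed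
  then have "AE \<omega> in M. \<forall>k. star_ineq (f_sketch F (S k \<omega>) (X k \<omega>)) (X k \<omega>) xs"
    by (simp add: AE_all_countable)
  with AE_space show ?thesis
  proof eventually_elim
    case (elim \<omega>)
    have "norm (X k \<omega> - xs) \<le> norm (x0 - xs)" for k
    proof (induction k)
      case 0
      then show ?case using elim by (simp add: X_0)
    next
      case (Suc k)
      have "V (Suc k) \<omega> \<le> V k \<omega> - 2 * \<gamma> * (1 - \<gamma>) * f_sketch F (S k \<omega>) (X k \<omega>) (X k \<omega>)"
        using snr_step_star[where F = F, OF diff_F spec[OF elim(2)] root \<gamma>(1)] elim(1) by (simp add: X_Suc)
      also have "\<dots> \<le> V k \<omega>"
        using \<gamma> f_sketch_nonneg[of F "S k \<omega>" "X k \<omega>" "X k \<omega>"] by simp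
      finally show ?case
        using Suc by (simp add: power2_le_iff_abs_le)
    qed
    then show ?case ..
  qed
qed

end

text \<open>The star inequalities are read almost surely. Integrability is part of the conclusion
  because a Bochner integral without it is 0 by convention, which would empty the bounds of
  content.\<close>

theorem theorem4p3:
  fixes F :: "real^'p \<Rightarrow> real^'m"
    and D :: "real^'p \<Rightarrow> (real^'t^'m) measure"
    and M :: "'w measure"
    and S :: "nat \<Rightarrow> 'w \<Rightarrow> real^'t^'m"
    and X :: "nat \<Rightarrow> 'w \<Rightarrow> real^'p"
    and x0 xs :: "real^'p"
    and \<gamma> :: real
  assumes "continuously_differentiable F"
    and "sketch_distributions F D"
    and "snr_process M F D \<gamma> x0 S X"
    and "0 < \<gamma>" and "\<gamma> < 1"
    and "F xs = 0"
    and "AE \<omega> in M. \<forall>k. star_ineq (f_mean F D (X k \<omega>)) (X k \<omega>) xs"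
  shows
    "(\<forall>t. integrable M (\<lambda>\<omega>. f_mean F D (X t \<omega>) (X t \<omega>))) \<and>
     (\<forall>k\<ge>1.
        integrable M (\<lambda>\<omega>. MIN t\<in>{..<k}. f_mean F D (X t \<omega>) (X t \<omega>)) \<and>
        (\<integral>\<omega>. (MIN t\<in>{..<k}. f_mean F D (X t \<omega>) (X t \<omega>)) \<partial>M)
          \<le> 1 / real k * (\<Sum>t<k. \<integral>\<omega>. f_mean F D (X t \<omega>) (X t \<omega>) \<partial>M) \<and>
        1 / real k * (\<Sum>t<k. \<integral>\<omega>. f_mean F D (X t \<omega>) (X t \<omega>) \<partial>M)
          \<le> 1 / real k * ((norm (x0 - xs))\<^sup>2 / (2 * \<gamma> * (1 - \<gamma>)))) \<and>
     (\<gamma> = 1/2 \<longrightarrow> (\<forall>k\<ge>1.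
        integrable M (\<lambda>\<omega>. MIN t\<in>{..<k}. (mat_seminorm (expected_H F D (X t \<omega>)) (F (X t \<omega>)))\<^sup>2) \<and>
        (\<integral>\<omega>. (MIN t\<in>{..<k}. (mat_seminorm (expected_H F D (X t \<omega>)) (F (X t \<omega>)))\<^sup>2) \<partial>M)
          \<le> 4 * (norm (x0 - xs))\<^sup>2 / real k)) \<and>
     ((AE \<omega> in M. \<forall>k. AE s in D (X k \<omega>). star_ineq (f_sketch F s (X k \<omega>)) (X k \<omega>) xs) \<longrightarrow>
        (AE \<omega> in M. \<forall>k. norm (X k \<omega> - xs) \<le> norm (x0 - xs)))"
proof -
  interpret snr F D M S X x0 xs \<gamma>
    by (unfold_locales; fact)
  note star = assms(7)
  have avg: "1 / real k * (\<Sum>t<k. \<integral>\<omega>. h t \<omega> \<partial>M)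
      \<le> 1 / real k * ((norm (x0 - xs))\<^sup>2 / (2 * \<gamma> * (1 - \<gamma>)))" for k
    by (intro mult_left_mono sum_descent[OF star]) simp
  have seminorm: "(MIN t\<in>{..<k}. (mat_seminorm (expected_H F D (X t \<omega>)) (F (X t \<omega>)))\<^sup>2)
      = 2 * (MIN t\<in>{..<k}. h t \<omega>)" if "1 \<le> k" for k \<omega>
  proof -
    \<comment> \<open>The squared seminorm is twice \<open>h\<close>, and doubling is monotone, so
      it commutes with the minimum of a nonempty finite set.\<close>
    have "(MIN t\<in>{..<k}. 2 * h t \<omega>) = 2 * (MIN t\<in>{..<k}. h t \<omega>)"
      using that by (subst mono_Min_commute[where f = "(*) 2"])
        (auto simp: mono_def lessThan_empty_iff image_image)
    then show ?thesis
      by (simp add: f_mean_eq_seminorm[where D = D and F = F, OF integrable_sketch_H])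
  qed
  \<comment> \<open>At \<open>\<gamma> = 1/2\<close> the denominator
    \<open>2 * \<gamma> * (1 - \<gamma>)\<close> equals 1/2; with the doubling this yields the
    factor 4.\<close>
  have "(\<integral>\<omega>. 2 * (MIN t\<in>{..<k}. h t \<omega>) \<partial>M) \<le> 4 * (norm (x0 - xs))\<^sup>2 / real k"
    if "1 \<le> k" "\<gamma> = 1/2" for k
  proof -
    have "(\<integral>\<omega>. (MIN t\<in>{..<k}. h t \<omega>) \<partial>M) \<le> 1 / real k * ((norm (x0 - xs))\<^sup>2 / (2 * \<gamma> * (1 - \<gamma>)))"
      using Min_h_le[OF star that(1)] avg by (rule order_trans)
    then show ?thesis
      by (simp add: that(2))
  qed
  then show ?thesis
    using integrable_h[OF star] integrable_Min_h[OF star] Min_h_le[OF star] avg norm_iterates_le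
    by (simp add: seminorm)
qed

end
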